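(* Let $n,k,t$ be integers with $1\le t\le k\le n/2$, let $C$ be a nonempty set of $k$-subsets of $\{1,\ldots,n\}$, and let $\mathbb{D}=(\{1,\ldots,n\},C)$. Then $\mathbb{D}$ is a $t$-design if and only if $$\sum_{w\in \mathrm{GF}(2)^n}\hat f_{\mathbb{D}}(w)^2\sum_{j=0}^{k}\frac{\mu_i}{v_j}\,Q_j(i)\,P_{2j}(\mathrm{wt}(w))=0$$ for all $i\in\{1,\ldots,t\}$.
   Context: $\mathbb{D}$ is a $t$-design if there is $\lambda$ such that every $t$-subset of $\{1,\ldots,n\}$ is contained in exactly $\lambda$ elements of $C$. The characteristic function $f_{\mathbb{D}}:\mathrm{GF}(2)^n\to\{0,1\}\subset\mathbb{R}$ has $f_{\mathbb{D}}(x)=1$ if and only if the support $\{i:x_i=1\}$ of $x$ belongs to $C$. The Walsh transform is $\hat f(w)=\sum_{x\in \mathrm{GF}(2)^n}f(x)(-1)^{w\cdot x}$ with $w\cdot x=\sum_iw_ix_i$; $\mathrm{wt}(w)$ is the Hamming weight. Krawtchouk polynomials: $P_m(x)=\sum_{j=0}^{m}(-1)^j\binom{x}{j}\binom{n-x}{m-j}$. Eberlein polynomials: $Q_l(x)=\sum_{j=0}^{l}(-1)^j\binom{x}{j}\binom{k-x}{l-j}\binom{n-k-x}{l-j}$. For $l\in\{0,\ldots,k\}$: $v_l=\binom{k}{l}\binom{n-k}{l}$ and $\mu_l=\frac{n-2l+1}{n-l+1}\binom{n}{l}$. *)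

theory Defs
  imports Complex_Main "HOL-Library.FuncSet" "HOL-Library.Z2"
begin

definition t_design :: "nat \<Rightarrow> 'a set \<times> 'a set set \<Rightarrow> bool" where
  "t_design t D \<longleftrightarrow>
     (\<exists>l::nat. \<forall>T. T \<subseteq> fst D \<and> card T = t \<longrightarrow> card {B \<in> snd D. T \<subseteq> B} = l)"

(* Vectors are indexed by 1..n; extensionality makes each vector a unique
   function, so that sums over GF2_vecs n have exactly 2^n terms. *)
definition GF2_vecs :: "nat \<Rightarrow> (nat \<Rightarrow> bit) set" where
  "GF2_vecs n = {1..n} \<rightarrow>\<^sub>E (UNIV :: bit set)"

definition supp :: "nat \<Rightarrow> (nat \<Rightarrow> bit) \<Rightarrow> nat set" where
  "supp n x = {i \<in> {1..n}. x i = 1}"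

definition wt :: "nat \<Rightarrow> (nat \<Rightarrow> bit) \<Rightarrow> nat" where
  "wt n x = card (supp n x)"

definition dot :: "nat \<Rightarrow> (nat \<Rightarrow> bit) \<Rightarrow> (nat \<Rightarrow> bit) \<Rightarrow> bit" where
  "dot n w x = (\<Sum>i=1..n. w i * x i)"

definition char_fun :: "nat \<Rightarrow> nat set \<times> nat set set \<Rightarrow> (nat \<Rightarrow> bit) \<Rightarrow> real" where
  "char_fun n D x = (if supp n x \<in> snd D then 1 else 0)"

(* The inner product lies in GF(2); of_bool reads it as the exponent 0 or 1. *)
definition walsh :: "nat \<Rightarrow> ((nat \<Rightarrow> bit) \<Rightarrow> real) \<Rightarrow> (nat \<Rightarrow> bit) \<Rightarrow> real" where
  "walsh n f w = (\<Sum>x\<in>GF2_vecs n. f x * (- 1) ^ of_bool (dot n w x = 1))"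

(* gchoose makes these polynomial functions of a real argument; where the upper
   argument is a natural number it is the ordinary binomial coefficient. *)
definition krawtchouk :: "nat \<Rightarrow> nat \<Rightarrow> real \<Rightarrow> real" where
  "krawtchouk n m x =
     (\<Sum>j=0..m. (- 1) ^ j * (x gchoose j) * ((real n - x) gchoose (m - j)))"

definition eberlein :: "nat \<Rightarrow> nat \<Rightarrow> nat \<Rightarrow> real \<Rightarrow> real" where
  "eberlein n k l x =
     (\<Sum>j=0..l. (- 1) ^ j * (x gchoose j) * ((real k - x) gchoose (l - j))
                 * ((real n - real k - x) gchoose (l - j)))"

definition valency :: "nat \<Rightarrow> nat \<Rightarrow> nat \<Rightarrow> real" where
  "valency n k l = real (k choose l) * real ((n - k) choose l)"

definition mult :: "nat \<Rightarrow> nat \<Rightarrow> real" where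
  "mult n l = (real n - 2 * real l + 1) / (real n - real l + 1) * real (n choose l)"

end

theory Submission
  imports Defs
begin

text \<open>
  Let \<open>N\<^sub>s\<close> be the sum of \<open>card (x \<inter> y) choose s\<close> over all ordered pairs of blocks. Both sides of the
  equivalence are statements about \<open>N\<^sub>0, \<dots>, N\<^sub>t\<close>.

  On the design side, \<open>N\<^sub>s\<close> is the sum of the squares of the numbers of blocks through the \<open>s\<close>-sets.
  The sum of these numbers is fixed by the number of blocks, so a family is an \<open>s\<close>-design if and only if \<open>N\<^sub>s\<close> has the
  smallest value that the Cauchy-Schwarz inequality permits
  (\<open>t_design_iff_intersection_moment\<close>). Since a \<open>t\<close>-design is an \<open>s\<close>-design for all \<open>s \<le> t\<close>, it is
  characterised by the vanishing of all the deviations \<open>d\<^sub>s\<close> of \<open>N\<^sub>s\<close> from that value, \<open>s \<le> t\<close>.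

  On the spectral side, orthogonality of characters shows that weighting the squared Walsh
  spectrum by \<open>P\<^sub>2\<^sub>j(wt(w))\<close> counts, up to the factor \<open>2 ^ n\<close>, the pairs of blocks \<open>x, y\<close> with
  \<open>card (x \<inter> y) = k - j\<close> (\<open>walsh_krawtchouk_distance_count\<close>). The \<open>i\<close>-th condition therefore
  concerns the sum of \<open>Q\<^sub>j(i) / v\<^sub>j\<close> over all pairs of blocks. The crucial algebraic fact
  (\<open>eberlein_hahn_expansion\<close>) is that \<open>Q\<^sub>j(i) / v\<^sub>j\<close> is a polynomial of degree exactly \<open>i\<close> in
  \<open>k - j\<close>; the definition gives only degree \<open>2 * i\<close> (\<open>eberlein_times_binomials\<close>), and the
  \<open>hypergeometric_transformation\<close> halves it. Expanded in binomial coefficients, it turns the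
  \<open>i\<close>-th condition into a linear relation between \<open>N\<^sub>0, \<dots>, N\<^sub>i\<close> with a nonzero coefficient at
  \<open>N\<^sub>i\<close>. The relation holds for the moments of a design, because it holds for the family of all
  \<open>k\<close>-sets, where it says that \<open>\<Sum>\<^sub>j Q\<^sub>j(i) = 0\<close> (\<open>hahn_coeff_annihilates_design_moments\<close>). So it
  may be read as a relation between the deviations \<open>d\<^sub>0, \<dots>, d\<^sub>i\<close>. As \<open>d\<^sub>0 = 0\<close>, the conditions
  for \<open>i = 1, \<dots>, t\<close> form a triangular homogeneous system with nonzero diagonal, and they hold if
  and only if all \<open>d\<^sub>s\<close> with \<open>s \<le> t\<close> vanish.
\<close>

section \<open>Binomial identities\<close>

text \<open>Trinomial revision in the form used below. The degenerate cases, where both sides are \<open>0\<close>,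
  are included so that it can be applied under summation signs.\<close>
lemma choose_mult_any:
  assumes "k \<le> m"
  shows "(n choose m) * (m choose k) = (n choose k) * ((n - k) choose (m - k))"
proof (cases "m \<le> n")
  case True
  then show ?thesis using choose_mult assms by simp
next
  case False
  then show ?thesis by (cases "k \<le> n") (auto simp: not_le binomial_eq_0 diff_less_mono)
qed

text \<open>Vandermonde's identity after splitting the upper argument as \<open>(a - (i - r)) + b\<close>; the factor
  in front absorbs one of the two resulting binomials by trinomial revision. Afterwards \<open>r\<close> occurs
  in a single binomial coefficient only, which lets a sum over \<open>r\<close> be evaluated.\<close>
lemma vandermonde_absorbing:
  fixes a b i r :: nat
  assumes "r \<le> i"
  shows "(a choose (i - r)) * ((a + b - (i - r)) choose r)
       = (\<Sum>l\<le>i. (a choose (i - l)) * (b choose l) * ((i - l) choose (i - r)))"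
proof (cases "i - r \<le> a")
  case True
  have "(a choose (i - r)) * ((a + b - (i - r)) choose r)
      = (a choose (i - r)) * (((a - (i - r)) + b) choose r)"
    using True by simp
  also have "\<dots> = (a choose (i - r)) * (\<Sum>l\<le>r. (b choose l) * ((a - (i - r)) choose (r - l)))"
    by (simp only: vandermonde add.commute)
  also have "\<dots> = (\<Sum>l\<le>r. (a choose (i - l)) * (b choose l) * ((i - l) choose (i - r)))"
    unfolding sum_distrib_left
  proof (rule sum.cong[OF refl])
    fix l assume l: "l \<in> {..r}"
    then have *: "i - l - (i - r) = r - l" using assms by simp
    show "(a choose (i - r)) * ((b choose l) * ((a - (i - r)) choose (r - l)))
        = (a choose (i - l)) * (b choose l) * ((i - l) choose (i - r))"
      using choose_mult_any[of "i - r" "i - l" a, unfolded *] l by (simp add: mult_ac)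
  qed
  also have "\<dots> = (\<Sum>l\<le>i. (a choose (i - l)) * (b choose l) * ((i - l) choose (i - r)))"
    using assms by (intro sum.mono_neutral_left) (auto simp: binomial_eq_0 diff_less_mono2)
  finally show ?thesis .
next
  case False
  have "(a choose (i - l)) * (b choose l) * ((i - l) choose (i - r)) = 0" for l
    using False by (cases "l \<le> r") (auto simp: binomial_eq_0)
  then show ?thesis using False by (simp add: binomial_eq_0)
qed

lemma vandermonde_absorbing_reflected:
  fixes c d i r :: nat
  assumes "r \<le> i"
  shows "(c choose r) * ((c + d - r) choose (i - r))
       = (\<Sum>u\<le>i. (c choose u) * (d choose (i - u)) * (u choose r))"
proof -
  have "(c choose r) * ((c + d - r) choose (i - r))
      = (\<Sum>l\<le>i. (c choose (i - l)) * (d choose l) * ((i - l) choose r))"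
    using vandermonde_absorbing[of "i - r" i c d] assms by simp
  also have "\<dots> = (\<Sum>u\<le>i. (c choose u) * (d choose (i - u)) * (u choose r))"
    by (rule sum.reindex_bij_witness[of _ "\<lambda>u. i - u" "\<lambda>u. i - u"]) auto
  finally show ?thesis .
qed

lemma choose_ratio:
  assumes "l \<le> r" "r \<le> u" "u \<le> i"
  shows "real ((i - l) choose (i - r)) * real (u choose r) / real (i choose r)
       = fact (i - l) * fact u / (fact i * fact (u - l)) * real ((u - l) choose (r - l))"
  using assms by (simp add: binomial_fact divide_simps)

text \<open>With \<open>r\<close> isolated, the factorials combine to \<open>(u - l) choose (r - l)\<close> times a factor free of
  \<open>r\<close>, so the sum is an alternating row sum of Pascal's triangle and vanishes unless \<open>u = l\<close>.\<close>
lemma alternating_kernel: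
  assumes "l \<le> i" "u \<le> i"
  shows "(\<Sum>r\<le>i. (-1) ^ r * (real ((i - l) choose (i - r)) * real (u choose r) / real (i choose r)))
       = (if u = l then (-1) ^ l / real (i choose l) else 0)"
proof (cases "l \<le> u")
  case False
  then have "real ((i - l) choose (i - r)) * real (u choose r) = 0" if "r \<le> i" for r
    using that assms by (cases "r \<le> u") (auto simp: binomial_eq_0 diff_less_mono2)
  then show ?thesis using False by (auto intro!: sum.neutral)
next
  case True
  let ?K = "fact (i - l) * fact u / (fact i * fact (u - l)) :: real"
  have "(\<Sum>r\<le>i. (-1) ^ r * (real ((i - l) choose (i - r)) * real (u choose r) / real (i choose r)))
      = (\<Sum>r\<in>{l..u}. (-1) ^ r * (real ((i - l) choose (i - r)) * real (u choose r) / real (i choose r)))"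
    using assms by (intro sum.mono_neutral_right) (auto simp: binomial_eq_0 not_le)
  also have "\<dots> = (\<Sum>r\<in>{l..u}. (-1) ^ r * (?K * real ((u - l) choose (r - l))))"
    using assms by (intro sum.cong refl) (subst choose_ratio, auto)
  also have "\<dots> = (\<Sum>p\<le>u - l. (-1) ^ (p + l) * (?K * real ((u - l) choose p)))"
    using True by (intro sum.reindex_bij_witness[of _ "\<lambda>p. p + l" "\<lambda>r. r - l"]) auto
  also have "\<dots> = (-1) ^ l * ?K * (\<Sum>p\<le>u - l. (-1) ^ p * real ((u - l) choose p))"
    unfolding sum_distrib_left by (intro sum.cong refl) (simp add: power_add)
  also have "\<dots> = (if u = l then (-1) ^ l / real (i choose l) else 0)"
  proof (cases "u = l")
    case True
    then show ?thesis using assms by (simp add: binomial_fact)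
  next
    case False
    then show ?thesis using True choose_alternating_sum[of "u - l", where 'a = real] by simp
  qed
  finally show ?thesis .
qed

text \<open>A transformation of terminating hypergeometric sums. Applied with \<open>a = k - j\<close>, \<open>b = c = j\<close>,
  \<open>d = n - k - j\<close>, the left side is a normalised Eberlein number, in which \<open>j\<close> occurs in four
  binomials of total degree \<open>2 * i\<close>; on the right \<open>a + b\<close> and \<open>c + d\<close> do not depend on \<open>j\<close>, so only
  degree \<open>i\<close> is left. The proof expands the right side by Vandermonde in both pairs and collapses it
  with the alternating kernel.

  There is also a combinatorial reading: up to a common factor, both sides sum the product of
  \<open>y\<^sub>p - y\<^sub>q\<close> over \<open>i\<close> disjoint pairs \<open>(p, q)\<close> with \<open>p\<close> inside and \<open>q\<close> outside a fixed set \<open>x\<close>, where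
  \<open>a, b, c, d\<close> are the sizes of the four cells cut out by \<open>x\<close> and \<open>y\<close>. The left side sorts the pairs
  by their contribution \<open>1\<close>, \<open>-1\<close> or \<open>0\<close>, the right side multiplies out the product first.\<close>
lemma hypergeometric_transformation:
  fixes a b c d i :: nat
  shows "(\<Sum>m\<le>i. (-1) ^ m * real (a choose (i - m)) * real (b choose m) * real (c choose m)
             * real (d choose (i - m)) / real (i choose m))
       = (\<Sum>r\<le>i. (-1) ^ r * real (a choose (i - r)) * real (c choose r)
             * real ((a + b - (i - r)) choose r) * real ((c + d - r) choose (i - r)) / real (i choose r))"
    (is "?L = ?R")
proof -
  let ?F = "\<lambda>l u. real (a choose (i - l)) * real (b choose l) * (real (c choose u) * real (d choose (i - u)))"
  let ?G = "\<lambda>r l u. (-1) ^ r * (real ((i - l) choose (i - r)) * real (u choose r) / real (i choose r))"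
  have "?R = (\<Sum>r\<le>i. \<Sum>l\<le>i. \<Sum>u\<le>i. ?F l u * ?G r l u)"
  proof (rule sum.cong[OF refl])
    fix r assume r: "r \<in> {..i}"
    have 1: "real (a choose (i - r)) * real ((a + b - (i - r)) choose r)
        = (\<Sum>l\<le>i. real (a choose (i - l)) * real (b choose l) * real ((i - l) choose (i - r)))"
      using vandermonde_absorbing[of r i a b] r by (simp flip: of_nat_mult of_nat_sum)
    have 2: "real (c choose r) * real ((c + d - r) choose (i - r))
       = (\<Sum>u\<le>i. real (c choose u) * real (d choose (i - u)) * real (u choose r))"
      using vandermonde_absorbing_reflected[of r i c d] r by (simp flip: of_nat_mult of_nat_sum)
    have "(-1) ^ r * real (a choose (i - r)) * real (c choose r)
             * real ((a + b - (i - r)) choose r) * real ((c + d - r) choose (i - r)) / real (i choose r)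
        = ((-1) ^ r / real (i choose r)) * ((real (a choose (i - r)) * real ((a + b - (i - r)) choose r))
          * (real (c choose r) * real ((c + d - r) choose (i - r))))"
      by simp
    also have "\<dots> = (\<Sum>l\<le>i. \<Sum>u\<le>i. ?F l u * ?G r l u)"
      unfolding 1 2 sum_product unfolding sum_distrib_left by (simp add: mult_ac)
    finally show "(-1) ^ r * real (a choose (i - r)) * real (c choose r)
             * real ((a + b - (i - r)) choose r) * real ((c + d - r) choose (i - r)) / real (i choose r)
         = (\<Sum>l\<le>i. \<Sum>u\<le>i. ?F l u * ?G r l u)" .
  qed
  also have "\<dots> = (\<Sum>l\<le>i. \<Sum>r\<le>i. \<Sum>u\<le>i. ?F l u * ?G r l u)"
    by (rule sum.swap)
  also have "\<dots> = (\<Sum>l\<le>i. \<Sum>u\<le>i. \<Sum>r\<le>i. ?F l u * ?G r l u)"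
    by (rule sum.cong[OF refl], rule sum.swap)
  also have "\<dots> = (\<Sum>l\<le>i. \<Sum>u\<le>i. ?F l u * (if u = l then (-1) ^ l / real (i choose l) else 0))"
    by (intro sum.cong refl) (simp only: alternating_kernel atMost_iff flip: sum_distrib_left)
  also have "\<dots> = (\<Sum>l\<le>i. ?F l l * ((-1) ^ l / real (i choose l)))"
    by (intro sum.cong refl) (simp add: if_distrib [of "\<lambda>x. _ * x"] sum.delta cong: if_cong)
  also have "\<dots> = ?L"
    by (intro sum.cong refl) simp
  finally show ?thesis ..
qed

text \<open>Inclusion and exclusion for the \<open>r\<close>-subsets of an \<open>(a + b)\<close>-set that avoid a given
  \<open>a\<close>-set.\<close>
lemma choose_diff_expansion:
  fixes a b r :: nat
  shows "(\<Sum>l\<le>r. (-1) ^ l * int (a choose l) * int ((b + a - l) choose (r - l))) = int (b choose r)"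
proof (induction a arbitrary: b r)
  case 0
  have "(\<Sum>l\<le>r. (-1) ^ l * int (0 choose l) * int ((b + 0 - l) choose (r - l)))
     = (\<Sum>l\<in>{0}. (-1) ^ l * int (0 choose l) * int ((b + 0 - l) choose (r - l)))"
    by (rule sum.mono_neutral_right) auto
  then show ?case by simp
next
  case (Suc a)
  show ?case
  proof (cases r)
    case 0
    then show ?thesis by simp
  next
    case (Suc q)
    have "(\<Sum>l\<le>Suc q. (-1) ^ l * int (Suc a choose l) * int ((b + Suc a - l) choose (Suc q - l)))
       = int ((b + Suc a) choose Suc q)
         + (\<Sum>l\<le>q. (-1) ^ Suc l * int (Suc a choose Suc l) * int ((b + Suc a - Suc l) choose (q - l)))"
      by (subst sum.atMost_Suc_shift) simp
    also have "(\<Sum>l\<le>q. (-1) ^ Suc l * int (Suc a choose Suc l) * int ((b + Suc a - Suc l) choose (q - l)))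
      = (\<Sum>l\<le>q. (-1) ^ Suc l * int (a choose Suc l) * int ((Suc b + a - Suc l) choose (q - l)))
        - (\<Sum>l\<le>q. (-1) ^ l * int (a choose l) * int ((b + a - l) choose (q - l)))"
      unfolding sum_subtractf[symmetric] by (intro sum.cong refl) (simp add: algebra_simps)
    also have "int ((b + Suc a) choose Suc q)
       + ((\<Sum>l\<le>q. (-1) ^ Suc l * int (a choose Suc l) * int ((Suc b + a - Suc l) choose (q - l)))
        - (\<Sum>l\<le>q. (-1) ^ l * int (a choose l) * int ((b + a - l) choose (q - l))))
      = (\<Sum>l\<le>Suc q. (-1) ^ l * int (a choose l) * int ((Suc b + a - l) choose (Suc q - l)))
        - (\<Sum>l\<le>q. (-1) ^ l * int (a choose l) * int ((b + a - l) choose (q - l)))"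
      by (simp add: sum.atMost_Suc_shift del: sum.atMost_Suc)
    also have "\<dots> = int (b choose Suc q)"
      unfolding Suc.IH by simp
    finally show ?thesis using Suc by simp
  qed
qed

text \<open>Change of basis: as a function of \<open>a\<close> the product on the left has degree \<open>i\<close>, and these are its
  coordinates in the basis \<open>a choose s\<close>. At \<open>s = i\<close> the coordinate is \<open>(-1) ^ (i + p) * (i choose p)\<close>.
  Together with the signs in the hypergeometric transformation these leading coordinates all have
  the same sign.\<close>
lemma mixed_product_expansion:
  fixes a i k p :: nat
  assumes "a \<le> k" "p \<le> i"
  shows "real (a choose p) * real ((k - a) choose (i - p))
       = (\<Sum>s\<le>i. (-1) ^ (s + p) * real (s choose p) * real ((k - s) choose (i - s)) * real (a choose s))"
proof (cases "p \<le> a")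
  case False
  have "real (s choose p) * real (a choose s) = 0" for s
    using False by (cases "s \<le> a") (auto simp: binomial_eq_0)
  then have "(\<Sum>s\<le>i. (-1) ^ (s + p) * real (s choose p) * real ((k - s) choose (i - s)) * real (a choose s)) = 0"
    by (intro sum.neutral) auto
  then show ?thesis using False by (simp add: binomial_eq_0)
next
  case True
  have "(\<Sum>s\<le>i. (-1) ^ (s + p) * real (s choose p) * real ((k - s) choose (i - s)) * real (a choose s))
     = (\<Sum>s\<in>{p..i}. (-1) ^ (s + p) * real (s choose p) * real ((k - s) choose (i - s)) * real (a choose s))"
    by (intro sum.mono_neutral_right) (auto simp: binomial_eq_0)
  also have "\<dots> = (\<Sum>l\<le>i - p. real (a choose p) * ((-1) ^ l * real ((a - p) choose l)
        * real (((k - a) + (a - p) - l) choose (i - p - l))))"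
  proof (intro sum.reindex_bij_witness[of _ "\<lambda>l. l + p" "\<lambda>s. s - p"])
    fix s assume s: "s \<in> {p..i}"
    have 1: "real (a choose s) * real (s choose p) = real (a choose p) * real ((a - p) choose (s - p))"
      using choose_mult_any[of p s a] s by (simp flip: of_nat_mult)
    have 2: "(k - a) + (a - p) - (s - p) = k - s" "i - p - (s - p) = i - s"
      using s True assms by auto
    have 3: "(-1 :: real) ^ (s + p) = (-1) ^ (s - p)"
      using s by (simp add: minus_one_power_iff)
    show "real (a choose p) * ((-1) ^ (s - p) * real ((a - p) choose (s - p))
        * real (((k - a) + (a - p) - (s - p)) choose (i - p - (s - p))))
       = (-1) ^ (s + p) * real (s choose p) * real ((k - s) choose (i - s)) * real (a choose s)"
      unfolding 2 3 using 1 by (simp add: mult_ac)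
  qed (use assms in auto)
  also have "\<dots> = real (a choose p) * real_of_int (\<Sum>l\<le>i - p. (-1) ^ l * int ((a - p) choose l)
        * int (((k - a) + (a - p) - l) choose (i - p - l)))"
    by (simp add: sum_distrib_left)
  also have "\<dots> = real (a choose p) * real ((k - a) choose (i - p))"
    by (subst choose_diff_expansion) simp
  finally show ?thesis ..
qed

text \<open>Both sides count the pairs of an \<open>i\<close>-subset and a \<open>j\<close>-subset of a \<open>k\<close>-set that meet in \<open>m\<close>
  points, and the count is symmetric in \<open>i\<close> and \<open>j\<close>. This is what exchanges the roles of degree and
  argument in the Eberlein polynomials.\<close>
lemma choose_pair_exchange:
  assumes "i \<le> k" "j \<le> k" "m \<le> i" "m \<le> j"
  shows "(k choose i) * (i choose m) * ((k - i) choose (j - m))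
       = (k choose j) * (j choose m) * ((k - j) choose (i - m))"
proof -
  have gen: "(k choose i) * (i choose m) * ((k - i) choose (j - m))
       = (k choose m) * ((k - m) choose ((i - m) + (j - m))) * (((i - m) + (j - m)) choose (i - m))"
    if "i \<le> k" "m \<le> i" "m \<le> j" for i j
  proof -
    have "(k choose i) * (i choose m) = (k choose m) * ((k - m) choose (i - m))"
      using choose_mult_any[of m i k] that by simp
    moreover have "((k - m) choose ((i - m) + (j - m))) * (((i - m) + (j - m)) choose (i - m))
       = ((k - m) choose (i - m)) * ((k - i) choose (j - m))"
      using choose_mult_any[of "i - m" "(i - m) + (j - m)" "k - m"] that by simp
    ultimately show ?thesis by (metis mult.assoc)
  qed
  have "((i - m) + (j - m)) choose (i - m) = ((j - m) + (i - m)) choose (j - m)"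
    using binomial_symmetric[of "i - m" "(i - m) + (j - m)"] by (simp add: add.commute)
  then show ?thesis
    using gen[of i j] gen[of j i] assms by (simp add: add.commute)
qed

section \<open>Eberlein polynomials in the intersection size\<close>

text \<open>The coordinates of the function \<open>j \<mapsto> Q\<^sub>j(i) / v\<^sub>j\<close>, a Hahn polynomial of degree \<open>i\<close>, in the
  basis \<open>(k - j) choose s\<close> for \<open>s \<le> i\<close>. The argument \<open>k - j\<close> is the size of the intersection of two
  \<open>k\<close>-sets at Johnson distance \<open>j\<close>.\<close>
definition hahn_coeff :: "nat \<Rightarrow> nat \<Rightarrow> nat \<Rightarrow> nat \<Rightarrow> real" where
  "hahn_coeff n k i s = (-1) ^ (s + i) * real ((k - s) choose (i - s))
     * (\<Sum>p\<le>i. real ((k - p) choose (i - p)) * real ((n - k - (i - p)) choose p)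
                 * real (s choose p) / real (i choose p))
     / (real (k choose i) * real ((n - k) choose i))"

text \<open>The sum over \<open>p\<close> has only positive terms, since the alternating signs have been factored out.
  This is what makes the system of spectral conditions triangular.\<close>
lemma hahn_coeff_leading_nonzero:
  assumes "i \<le> k" "2 * k \<le> n"
  shows "hahn_coeff n k i i \<noteq> 0"
proof -
  have "(\<Sum>p\<le>i. real ((k - p) choose (i - p)) * real ((n - k - (i - p)) choose p)
                 * real (i choose p) / real (i choose p)) > 0"
    using assms by (intro sum_pos) auto
  then show ?thesis
    using assms by (simp add: hahn_coeff_def)
qed

text \<open>The generalised binomials are ordinary ones here because \<open>i \<le> k \<le> n - k\<close>.\<close>
lemma eberlein_nat:
  assumes "i \<le> k" "2 * k \<le> n"
  shows "eberlein n k l (real i) = (\<Sum>m\<le>l. (-1) ^ m * real (i choose m)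
           * real ((k - i) choose (l - m)) * real ((n - k - i) choose (l - m)))"
proof -
  have "real k - real i = real (k - i)" "real n - real k - real i = real (n - k - i)"
    using assms by auto
  then show ?thesis
    by (simp only: eberlein_def binomial_gbinomial atLeast0AtMost)
qed

text \<open>Exchanging \<open>i\<close> and \<open>j\<close> in each pair of binomials moves the variable \<open>j\<close> from the lower
  indices to the upper arguments, and the factor that depends on \<open>j\<close> alone is the valency. After
  division by it, a polynomial in \<open>j\<close> is left.\<close>
lemma eberlein_times_binomials:
  assumes "i \<le> k" "j \<le> k" "2 * k \<le> n"
  shows "eberlein n k j (real i) * (real (k choose i) * real ((n - k) choose i))
       = valency n k j * (\<Sum>m\<le>i. (-1) ^ m * real ((k - j) choose (i - m)) * real (j choose m)
            * real (j choose m) * real ((n - k - j) choose (i - m)) / real (i choose m))"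
proof -
  let ?f = "\<lambda>m. (-1) ^ m * real (i choose m) * real ((k - i) choose (j - m))
              * real ((n - k - i) choose (j - m)) * (real (k choose i) * real ((n - k) choose i))"
  have "eberlein n k j (real i) * (real (k choose i) * real ((n - k) choose i)) = (\<Sum>m\<le>j. ?f m)"
    by (simp add: eberlein_nat[OF assms(1,3)] sum_distrib_right)
  also have "\<dots> = (\<Sum>m\<in>{..i} \<inter> {..j}. ?f m)"
    by (intro sum.mono_neutral_right) (auto simp: binomial_eq_0)
  also have "\<dots> = (\<Sum>m\<in>{..i} \<inter> {..j}. valency n k j * ((-1) ^ m * real ((k - j) choose (i - m)) * real (j choose m)
            * real (j choose m) * real ((n - k - j) choose (i - m)) / real (i choose m)))"
  proof (rule sum.cong[OF refl])
    fix m assume "m \<in> {..i} \<inter> {..j}"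
    then have m: "m \<le> i" "m \<le> j" by auto
    have 1: "real (k choose i) * real (i choose m) * real ((k - i) choose (j - m))
       = real (k choose j) * real (j choose m) * real ((k - j) choose (i - m))"
      unfolding of_nat_mult[symmetric] using assms m by (subst choose_pair_exchange) auto
    have 2: "real ((n - k) choose i) * real (i choose m) * real ((n - k - i) choose (j - m))
       = real ((n - k) choose j) * real (j choose m) * real ((n - k - j) choose (i - m))"
      unfolding of_nat_mult[symmetric] using assms m by (subst choose_pair_exchange) auto
    have cancel: "\<sigma> * c * x * y * (K * M) = \<sigma> * (K * c * x) * (M * c * y) / c" if "c \<noteq> 0"
      for \<sigma> c x y K M :: real
      using that by (simp add: field_simps)
    have "?f m = (-1) ^ m * (real (k choose i) * real (i choose m) * real ((k - i) choose (j - m)))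
           * (real ((n - k) choose i) * real (i choose m) * real ((n - k - i) choose (j - m))) / real (i choose m)"
      using m by (intro cancel) simp
    also have "\<dots> = valency n k j * ((-1) ^ m * real ((k - j) choose (i - m)) * real (j choose m)
            * real (j choose m) * real ((n - k - j) choose (i - m)) / real (i choose m))"
      unfolding 1 2 valency_def by (simp only: mult_ac times_divide_eq_left times_divide_eq_right)
    finally show "?f m = valency n k j * ((-1) ^ m * real ((k - j) choose (i - m)) * real (j choose m)
            * real (j choose m) * real ((n - k - j) choose (i - m)) / real (i choose m))" .
  qed
  also have "\<dots> = (\<Sum>m\<le>i. valency n k j * ((-1) ^ m * real ((k - j) choose (i - m)) * real (j choose m)
            * real (j choose m) * real ((n - k - j) choose (i - m)) / real (i choose m)))"
    by (intro sum.mono_neutral_left) (auto simp: binomial_eq_0)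
  finally show ?thesis by (simp add: sum_distrib_left)
qed

text \<open>The transformation leaves, in the summand \<open>r = i - p\<close>, only the product of
  \<open>(k - j) choose p\<close> and \<open>j choose (i - p)\<close> depending on \<open>j\<close>, which is then expanded in the
  binomial basis in \<open>k - j\<close>.\<close>
lemma eberlein_hahn_expansion:
  assumes "i \<le> k" "j \<le> k" "2 * k \<le> n"
  shows "eberlein n k j (real i)
       = valency n k j * (\<Sum>s\<le>i. hahn_coeff n k i s * real ((k - j) choose s))"
proof -
  let ?N = "real (k choose i) * real ((n - k) choose i)"
  let ?w = "\<lambda>p. real ((k - p) choose (i - p)) * real ((n - k - (i - p)) choose p) / real (i choose p)"
  have N: "?N \<noteq> 0" using assms by simp
  have "(\<Sum>m\<le>i. (-1) ^ m * real ((k - j) choose (i - m)) * real (j choose m)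
            * real (j choose m) * real ((n - k - j) choose (i - m)) / real (i choose m))
     = (\<Sum>r\<le>i. (-1) ^ r * real ((k - j) choose (i - r)) * real (j choose r)
            * real ((k - (i - r)) choose r) * real ((n - k - r) choose (i - r)) / real (i choose r))"
    using hypergeometric_transformation[where a = "k - j" and b = j and c = j and d = "n - k - j" and i = i] assms
    by simp
  also have "\<dots> = (\<Sum>p\<le>i. (-1) ^ (i - p) * (real ((k - j) choose p) * real ((k - (k - j)) choose (i - p))) * ?w p)"
    using assms
    by (intro sum.reindex_bij_witness[of _ "\<lambda>p. i - p" "\<lambda>r. i - r"])
       (auto simp: binomial_symmetric[symmetric])
  also have "\<dots> = (\<Sum>p\<le>i. \<Sum>s\<le>i. (-1) ^ (s + i) * real ((k - s) choose (i - s))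
                 * (?w p * real (s choose p)) * real ((k - j) choose s))"
  proof (rule sum.cong[OF refl])
    fix p assume p: "p \<in> {..i}"
    have sgn: "(-1 :: real) ^ (s + i) = (-1) ^ (i - p) * (-1) ^ (s + p)" for s
      using p by (simp add: minus_one_power_iff)
    show "(-1) ^ (i - p) * (real ((k - j) choose p) * real ((k - (k - j)) choose (i - p))) * ?w p
       = (\<Sum>s\<le>i. (-1) ^ (s + i) * real ((k - s) choose (i - s))
                 * (?w p * real (s choose p)) * real ((k - j) choose s))"
      unfolding sgn using p
      by (subst mixed_product_expansion) (auto simp: sum_distrib_left sum_distrib_right mult_ac)
  qed
  also have "\<dots> = (\<Sum>s\<le>i. \<Sum>p\<le>i. (-1) ^ (s + i) * real ((k - s) choose (i - s))
                 * (?w p * real (s choose p)) * real ((k - j) choose s))"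
    by (rule sum.swap)
  also have "\<dots> = (\<Sum>s\<le>i. ?N * (hahn_coeff n k i s * real ((k - j) choose s)))"
  proof (rule sum.cong[OF refl])
    fix s
    have "?N * hahn_coeff n k i s
        = (-1) ^ (s + i) * real ((k - s) choose (i - s)) * (\<Sum>p\<le>i. ?w p * real (s choose p))"
      using N by (simp add: hahn_coeff_def)
    then show "(\<Sum>p\<le>i. (-1) ^ (s + i) * real ((k - s) choose (i - s))
                 * (?w p * real (s choose p)) * real ((k - j) choose s))
        = ?N * (hahn_coeff n k i s * real ((k - j) choose s))"
      by (simp only: mult.assoc[symmetric] sum_distrib_left sum_distrib_right)
  qed
  also have "\<dots> = ?N * (\<Sum>s\<le>i. hahn_coeff n k i s * real ((k - j) choose s))"
    by (rule sum_distrib_left[symmetric])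
  finally have "eberlein n k j (real i) * ?N
      = (valency n k j * (\<Sum>s\<le>i. hahn_coeff n k i s * real ((k - j) choose s))) * ?N"
    using eberlein_times_binomials[OF assms] by (simp only: mult_ac)
  then show ?thesis using N by (simp only: mult_cancel_right simp_thms)
qed

text \<open>For \<open>i \<ge> 1\<close> the double sum is a product whose first factor is the alternating sum of row \<open>i\<close> of
  Pascal's triangle. In the Johnson scheme this is the orthogonality of the \<open>i\<close>-th eigenspace to the
  constant functions.\<close>
lemma sum_eberlein_eq_0:
  assumes "1 \<le> i" "i \<le> k" "2 * k \<le> n"
  shows "(\<Sum>j\<le>k. eberlein n k j (real i)) = 0"
proof -
  let ?g = "\<lambda>l. real ((k - i) choose l) * real ((n - k - i) choose l)"
  have "(\<Sum>j\<le>k. eberlein n k j (real i))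
      = (\<Sum>j\<le>k. \<Sum>m\<le>j. (-1) ^ m * real (i choose m) * ?g (j - m))"
    using eberlein_nat[OF assms(2,3)] by (simp add: mult.assoc)
  also have "\<dots> = (\<Sum>(m, l)\<in>{(m, l). m + l \<le> k}. (-1) ^ m * real (i choose m) * ?g l)"
    by (simp add: sum.triangle_reindex_eq)
  also have "\<dots> = (\<Sum>(m, l)\<in>{..i} \<times> {..k - i}. (-1) ^ m * real (i choose m) * ?g l)"
  proof (rule sum.mono_neutral_right)
    have "{(m, l). m + l \<le> k} \<subseteq> {..k} \<times> {..k}" by auto
    then show "finite {(m, l). m + l \<le> k}" by (rule finite_subset) simp
    show "{..i} \<times> {..k - i} \<subseteq> {(m, l). m + l \<le> k}" using assms by auto
  qed (auto simp: binomial_eq_0)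
  also have "\<dots> = (\<Sum>m\<le>i. (-1) ^ m * real (i choose m)) * (\<Sum>l\<le>k - i. ?g l)"
    by (simp add: sum_product sum.cartesian_product)
  also have "\<dots> = 0"
    using choose_alternating_sum[of i, where 'a = real] assms by simp
  finally show ?thesis .
qed

lemma choose_subset_swap:
  assumes "s \<le> k" "k \<le> n"
  shows "real ((n - s) choose (k - s)) = real (n choose k) * real (k choose s) / real (n choose s)"
  using choose_mult_any[of s k n] assms by (simp add: field_simps flip: of_nat_mult)

text \<open>For a fixed \<open>k\<close>-set \<open>x\<close>, the left side sums \<open>card (x \<inter> y) choose s\<close> over all \<open>k\<close>-sets
  \<open>y\<close>, because \<open>v\<^sub>j\<close> of them are at distance \<open>j\<close> from \<open>x\<close>. The quotient on the right is, up to the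
  square of the number of blocks, the \<open>s\<close>-th moment of an \<open>s\<close>-design.\<close>
lemma valency_moment:
  assumes "s \<le> k" "k \<le> n"
  shows "(\<Sum>j\<le>k. valency n k j * real ((k - j) choose s))
       = real (n choose k) * ((real (k choose s))\<^sup>2 / real (n choose s))"
proof -
  have "(\<Sum>j\<le>k. valency n k j * real ((k - j) choose s))
      = (\<Sum>j\<le>k - s. valency n k j * real ((k - j) choose s))"
    by (intro sum.mono_neutral_right) (auto simp: binomial_eq_0)
  also have "\<dots> = (\<Sum>j\<le>k - s. real (k choose s) * real (((n - k) choose j) * ((k - s) choose (k - s - j))))"
  proof (rule sum.cong[OF refl])
    fix j assume j: "j \<in> {..k - s}"
    have "(k choose j) * ((k - j) choose s) = (k choose s) * ((k - s) choose (k - s - j))"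
      using choose_mult_any[of s "k - j" k] binomial_symmetric[of j k] j assms
      by (simp add: add.commute)
    then have "real (k choose j) * real ((k - j) choose s) = real (k choose s) * real ((k - s) choose (k - s - j))"
      by (simp flip: of_nat_mult)
    then show "valency n k j * real ((k - j) choose s)
      = real (k choose s) * real (((n - k) choose j) * ((k - s) choose (k - s - j)))"
      by (simp add: valency_def)
  qed
  also have "\<dots> = real (k choose s) * real ((n - s) choose (k - s))"
    using assms vandermonde[of "n - k" "k - s" "k - s"]
    by (simp only: flip: sum_distrib_left of_nat_sum) simp
  finally show ?thesis
    using assms by (simp add: choose_subset_swap power2_eq_square)
qed

text \<open>The complete design has zero spectral sums for \<open>i \<ge> 1\<close> by the vanishing of
  \<open>\<Sum>\<^sub>j Q\<^sub>j(i)\<close>, and the moments of every other design are proportional to its moments. Reading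
  the relation off this one example avoids summing the coefficients themselves.\<close>
lemma hahn_coeff_annihilates_design_moments:
  assumes "1 \<le> i" "i \<le> k" "2 * k \<le> n"
  shows "(\<Sum>s\<le>i. hahn_coeff n k i s * ((real (k choose s))\<^sup>2 / real (n choose s))) = 0"
proof -
  have "0 = (\<Sum>j\<le>k. eberlein n k j (real i))"
    using sum_eberlein_eq_0[OF assms] ..
  also have "\<dots> = (\<Sum>j\<le>k. valency n k j * (\<Sum>s\<le>i. hahn_coeff n k i s * real ((k - j) choose s)))"
    using assms by (intro sum.cong refl eberlein_hahn_expansion) auto
  also have "\<dots> = (\<Sum>s\<le>i. hahn_coeff n k i s * (\<Sum>j\<le>k. valency n k j * real ((k - j) choose s)))"
    unfolding sum_distrib_left by (subst sum.swap) (simp only: mult_ac)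
  also have "\<dots> = (\<Sum>s\<le>i. hahn_coeff n k i s * (real (n choose k) * ((real (k choose s))\<^sup>2 / real (n choose s))))"
    using assms by (intro sum.cong refl, subst valency_moment) auto
  also have "\<dots> = real (n choose k) * (\<Sum>s\<le>i. hahn_coeff n k i s * ((real (k choose s))\<^sup>2 / real (n choose s)))"
    unfolding sum_distrib_left by (simp only: mult_ac)
  finally show ?thesis using assms by simp
qed

section \<open>Designs and moments of intersection sizes\<close>

definition cover_count :: "'a set set \<Rightarrow> 'a set \<Rightarrow> nat" where
  "cover_count C S = card {B \<in> C. S \<subseteq> B}"

text \<open>The second moment of the covering counts of \<open>s\<close>-sets, written through pairs of blocks; this
  form links designs with the distance distribution.\<close>
definition intersection_moment :: "'a set set \<Rightarrow> nat \<Rightarrow> real" where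
  "intersection_moment C s = (\<Sum>x\<in>C. \<Sum>y\<in>C. real (card (x \<inter> y) choose s))"

lemma cover_count_sum:
  "finite C \<Longrightarrow> real (cover_count C S) = (\<Sum>B\<in>C. of_bool (S \<subseteq> B))"
  by (simp add: cover_count_def Int_def)

lemma sum_of_bool_card:
  assumes "finite A"
  shows "(\<Sum>a\<in>A. of_bool (P a) :: real) = real (card {a\<in>A. P a})"
  using assms by (simp add: Int_def)

lemma sum_cover_count:
  assumes "finite U" and "\<And>B. B \<in> C \<Longrightarrow> B \<subseteq> U \<and> card B = k"
  shows "(\<Sum>S | S \<subseteq> U \<and> card S = s. real (cover_count C S)) = real (card C) * real (k choose s)"
proof -
  have finC: "finite C" using assms by (meson PowI finite_Pow_iff finite_subset subsetI)
  have "(\<Sum>S | S \<subseteq> U \<and> card S = s. real (cover_count C S))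
      = (\<Sum>B\<in>C. \<Sum>S | S \<subseteq> U \<and> card S = s. of_bool (S \<subseteq> B))"
    unfolding cover_count_sum[OF finC] by (rule sum.swap)
  also have "\<dots> = (\<Sum>B\<in>C. real (k choose s))"
  proof (rule sum.cong[OF refl])
    fix B assume B: "B \<in> C"
    have "{S \<in> {S. S \<subseteq> U \<and> card S = s}. S \<subseteq> B} = {S. S \<subseteq> B \<and> card S = s}"
      using assms(2)[OF B] by auto
    then show "(\<Sum>S | S \<subseteq> U \<and> card S = s. of_bool (S \<subseteq> B)) = real (k choose s)"
      using assms(2)[OF B] assms(1) by (subst sum_of_bool_card) (auto simp: n_subsets finite_subset)
  qed
  finally show ?thesis by simp
qed

lemma sum_cover_count_squared:
  assumes "finite U" and "C \<subseteq> Pow U"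
  shows "(\<Sum>S | S \<subseteq> U \<and> card S = s. (real (cover_count C S))\<^sup>2) = intersection_moment C s"
proof -
  have finC: "finite C" using assms by (meson finite_Pow_iff finite_subset)
  have "(\<Sum>S | S \<subseteq> U \<and> card S = s. (real (cover_count C S))\<^sup>2)
      = (\<Sum>S | S \<subseteq> U \<and> card S = s. \<Sum>(x, y)\<in>C \<times> C. of_bool (S \<subseteq> x \<inter> y))"
    unfolding cover_count_sum[OF finC] power2_eq_square sum_product sum.cartesian_product
    by (intro sum.cong refl) auto
  also have "\<dots> = (\<Sum>(x, y)\<in>C \<times> C. \<Sum>S | S \<subseteq> U \<and> card S = s. of_bool (S \<subseteq> x \<inter> y))"
    by (subst sum.swap) (simp add: case_prod_beta)
  also have "\<dots> = (\<Sum>(x, y)\<in>C \<times> C. real (card (x \<inter> y) choose s))"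
  proof (rule sum.cong[OF refl], clarify)
    fix x y assume xy: "x \<in> C" "y \<in> C"
    have "{S \<in> {S. S \<subseteq> U \<and> card S = s}. S \<subseteq> x \<inter> y} = {S. S \<subseteq> x \<inter> y \<and> card S = s}"
      using assms xy by auto
    moreover have "finite (x \<inter> y)" using assms xy by (meson PowD finite_Int finite_subset subsetD)
    ultimately show "(\<Sum>S | S \<subseteq> U \<and> card S = s. of_bool (S \<subseteq> x \<inter> y)) = real (card (x \<inter> y) choose s)"
      using assms(1) n_subsets[of "x \<inter> y" s] by (subst sum_of_bool_card) simp_all
  qed
  finally show ?thesis
    by (simp add: intersection_moment_def sum.cartesian_product)
qed

text \<open>Among families of \<open>k\<close>-subsets, the mean of \<open>cover_count\<close> over the \<open>s\<close>-subsets depends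
  only on the number of blocks, while its second moment is \<open>intersection_moment\<close>. Being a design means zero variance, that is,
  equality in the Cauchy-Schwarz inequality.\<close>
lemma t_design_iff_intersection_moment:
  assumes U: "finite U" "card U = n" and C: "\<And>B. B \<in> C \<Longrightarrow> B \<subseteq> U \<and> card B = k" and "s \<le> n"
  shows "t_design s (U, C)
     \<longleftrightarrow> intersection_moment C s = (real (card C))\<^sup>2 * ((real (k choose s))\<^sup>2 / real (n choose s))"
proof -
  let ?\<S> = "{S. S \<subseteq> U \<and> card S = s}"
  let ?N = "real (n choose s)"
  let ?M = "real (card C) * real (k choose s)"
  have N: "?N > 0" using assms by simp
  have fin: "finite ?\<S>" using U by simp
  have cardS: "real (card ?\<S>) = ?N" using n_subsets[OF U(1)] U by simp
  have sum1: "(\<Sum>S\<in>?\<S>. real (cover_count C S)) = ?M"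
    by (rule sum_cover_count[OF U(1) C])
  have "(\<Sum>S\<in>?\<S>. (real (cover_count C S) - ?M / ?N)\<^sup>2)
      = (\<Sum>S\<in>?\<S>. (real (cover_count C S))\<^sup>2) - 2 * (?M / ?N) * (\<Sum>S\<in>?\<S>. real (cover_count C S))
        + ?N * (?M / ?N)\<^sup>2"
    by (simp add: power2_diff sum.distrib sum_subtractf cardS sum_distrib_left sum_divide_distrib mult_ac)
  also have "\<dots> = intersection_moment C s - ?M\<^sup>2 / ?N"
    unfolding sum1 using sum_cover_count_squared[OF U(1), of C s] C N
    by (simp add: subset_iff power2_eq_square)
  finally have var: "(\<Sum>S\<in>?\<S>. (real (cover_count C S) - ?M / ?N)\<^sup>2) = intersection_moment C s - ?M\<^sup>2 / ?N" .
  have "t_design s (U, C) \<longleftrightarrow> (\<forall>S\<in>?\<S>. real (cover_count C S) = ?M / ?N)"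
  proof
    assume "t_design s (U, C)"
    then obtain l where l: "\<And>S. S \<in> ?\<S> \<Longrightarrow> cover_count C S = l"
      by (auto simp: t_design_def cover_count_def)
    then have "?N * real l = ?M" using sum1 cardS by simp
    then show "\<forall>S\<in>?\<S>. real (cover_count C S) = ?M / ?N"
      using l N by (auto simp: field_simps)
  next
    assume *: "\<forall>S\<in>?\<S>. real (cover_count C S) = ?M / ?N"
    obtain S0 where "S0 \<in> ?\<S>"
      using cardS N by (metis card.empty equals0I of_nat_0 less_irrefl)
    then have "\<forall>S\<in>?\<S>. cover_count C S = cover_count C S0"
      using * by (metis of_nat_eq_iff)
    then show "t_design s (U, C)"
      by (auto simp: t_design_def cover_count_def)
  qed
  also have "\<dots> \<longleftrightarrow> (\<Sum>S\<in>?\<S>. (real (cover_count C S) - ?M / ?N)\<^sup>2) = 0"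
    using fin by (subst sum_nonneg_eq_0_iff) auto
  finally show ?thesis
    unfolding var by (simp add: power_mult_distrib)
qed

text \<open>Double counting the pairs of a \<open>t\<close>-set \<open>T\<close> and a block \<open>B\<close> with \<open>S \<subseteq> T \<subseteq> B\<close>: each block
  containing \<open>S\<close> contributes equally, so the number of those blocks is determined by the number of blocks
  through a \<open>t\<close>-set.\<close>
lemma t_design_mono:
  assumes U: "finite U" "card U = n" and C: "\<And>B. B \<in> C \<Longrightarrow> B \<subseteq> U \<and> card B = k"
    and "s \<le> t" "t \<le> k" and des: "t_design t (U, C)"
  shows "t_design s (U, C)"
proof -
  have finC: "finite C" using U C by (meson PowI finite_Pow_iff finite_subset subsetI)
  from des obtain l where l: "\<And>T. T \<subseteq> U \<Longrightarrow> card T = t \<Longrightarrow> cover_count C T = l"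
    by (auto simp: t_design_def cover_count_def)
  have ext: "card {T. S \<subseteq> T \<and> T \<subseteq> B \<and> card T = t} = (card B - s) choose (t - s)"
    if "S \<subseteq> B" "B \<subseteq> U" "card S = s" for S B
  proof -
    have fin: "finite B" "finite S" using that U by (auto intro: finite_subset)
    have "bij_betw (\<lambda>R. R \<union> S) {R. R \<subseteq> B - S \<and> card R = t - s} {T. S \<subseteq> T \<and> T \<subseteq> B \<and> card T = t}"
    proof (rule bij_betw_byWitness[where f' = "\<lambda>T. T - S"])
      show "(\<lambda>R. R \<union> S) ` {R. R \<subseteq> B - S \<and> card R = t - s} \<subseteq> {T. S \<subseteq> T \<and> T \<subseteq> B \<and> card T = t}"
      proof clarify
        fix R assume R: "R \<subseteq> B - S" "card R = t - s"
        then have "card (R \<union> S) = card R + card S"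
          using fin by (intro card_Un_disjoint) (auto intro: finite_subset)
        then show "S \<subseteq> R \<union> S \<and> R \<union> S \<subseteq> B \<and> card (R \<union> S) = t"
          using R that assms(4) by auto
      qed
      show "(\<lambda>T. T - S) ` {T. S \<subseteq> T \<and> T \<subseteq> B \<and> card T = t} \<subseteq> {R. R \<subseteq> B - S \<and> card R = t - s}"
        using that fin by (auto simp: card_Diff_subset)
    qed auto
    then have "card {T. S \<subseteq> T \<and> T \<subseteq> B \<and> card T = t} = card {R. R \<subseteq> B - S \<and> card R = t - s}"
      by (simp add: bij_betw_same_card)
    also have "\<dots> = card (B - S) choose (t - s)"
      using fin by (intro n_subsets) auto
    finally show ?thesis using that fin by (simp add: card_Diff_subset)
  qed
  have key: "cover_count C S * ((k - s) choose (t - s)) = ((n - s) choose (t - s)) * l"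
    if S: "S \<subseteq> U" "card S = s" for S
  proof -
    let ?\<T> = "{T. S \<subseteq> T \<and> T \<subseteq> U \<and> card T = t}"
    have finT: "finite ?\<T>" using U by simp
    have "real ((n - s) choose (t - s)) * real l = (\<Sum>T\<in>?\<T>. real (cover_count C T))"
      using l ext[of S U] S U by simp
    also have "\<dots> = (\<Sum>B\<in>C. \<Sum>T\<in>?\<T>. of_bool (T \<subseteq> B))"
      unfolding cover_count_sum[OF finC] by (rule sum.swap)
    also have "\<dots> = (\<Sum>B\<in>C. of_bool (S \<subseteq> B) * real ((k - s) choose (t - s)))"
    proof (rule sum.cong[OF refl])
      fix B assume B: "B \<in> C"
      show "(\<Sum>T\<in>?\<T>. of_bool (T \<subseteq> B)) = of_bool (S \<subseteq> B) * real ((k - s) choose (t - s))"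
      proof (cases "S \<subseteq> B")
        case True
        have "{T \<in> ?\<T>. T \<subseteq> B} = {T. S \<subseteq> T \<and> T \<subseteq> B \<and> card T = t}"
          using C[OF B] by auto
        then show ?thesis
          using ext[of S B] True C[OF B] S by (subst sum_of_bool_card[OF finT]) simp
      next
        case False
        then have "(\<Sum>T\<in>?\<T>. of_bool (T \<subseteq> B) :: real) = 0" by (intro sum.neutral) auto
        then show ?thesis using False by simp
      qed
    qed
    also have "\<dots> = real (cover_count C S) * real ((k - s) choose (t - s))"
      unfolding cover_count_sum[OF finC] by (simp only: sum_distrib_right)
    finally show ?thesis
      by (simp flip: of_nat_mult)
  qed
  have "(k - s) choose (t - s) > 0" using assms by simp
  then have "cover_count C S = ((n - s) choose (t - s)) * l div ((k - s) choose (t - s))"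
    if "S \<subseteq> U" "card S = s" for S
    using key[OF that] by (metis nonzero_mult_div_cancel_right less_irrefl)
  then show ?thesis
    by (auto simp: t_design_def cover_count_def)
qed

section \<open>Walsh spectrum and distance distribution\<close>

lemma character_as_product:
  assumes "finite W"
  shows "(-1 :: real) ^ card (W \<inter> x) = (\<Prod>e\<in>W. if e \<in> x then -1 else 1)"
  using assms by (simp add: prod.If_cases)

text \<open>As a sum over subsets, the product of the three characters factors over the points \<open>e\<close> of
  \<open>U\<close>; the factor at \<open>e\<close> is \<open>1 + 1\<close> if \<open>e\<close> lies in an even number of the three sets and \<open>1 - 1\<close>
  otherwise.\<close>
lemma character_orthogonality:
  assumes "finite U" "x \<subseteq> U" "y \<subseteq> U" "S \<subseteq> U"
  shows "(\<Sum>W\<in>Pow U. (-1 :: real) ^ card (W \<inter> x) * (-1) ^ card (W \<inter> y) * (-1) ^ card (W \<inter> S))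
       = of_bool (S = sym_diff x y) * 2 ^ card U"
proof -
  let ?h = "\<lambda>z e. if e \<in> z then -1 else 1 :: real"
  let ?g = "\<lambda>e. ?h x e * ?h y e * ?h S e"
  have "(\<Sum>W\<in>Pow U. (-1 :: real) ^ card (W \<inter> x) * (-1) ^ card (W \<inter> y) * (-1) ^ card (W \<inter> S))
      = (\<Sum>W\<in>Pow U. \<Prod>e\<in>W. ?g e)"
  proof (rule sum.cong[OF refl])
    fix W assume "W \<in> Pow U"
    then have "finite W" using assms by (auto intro: finite_subset)
    then show "(-1 :: real) ^ card (W \<inter> x) * (-1) ^ card (W \<inter> y) * (-1) ^ card (W \<inter> S) = (\<Prod>e\<in>W. ?g e)"
      unfolding prod.distrib by (simp only: character_as_product)
  qed
  also have "\<dots> = (\<Prod>e\<in>U. ?g e + 1)"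
    by (subst prod_add[OF assms(1)]) simp
  also have "\<dots> = of_bool (S = sym_diff x y) * 2 ^ card U"
  proof (cases "S = sym_diff x y")
    case True
    have "(\<Prod>e\<in>U. ?g e + 1) = (\<Prod>e\<in>U. 2)"
      by (intro prod.cong refl) (auto simp: True)
    then show ?thesis using True by simp
  next
    case False
    then obtain e where e: "e \<in> S \<longleftrightarrow> e \<notin> sym_diff x y" by (auto simp only: set_eq_iff)
    then have "e \<in> U" using assms by auto
    with e have "\<exists>e\<in>U. ?g e + 1 = 0" by (intro bexI[of _ e]) auto
    then show ?thesis using False prod_zero[OF assms(1), of "\<lambda>e. ?g e + 1"] by simp
  qed
  finally show ?thesis .
qed

text \<open>The Krawtchouk polynomial is the character sum over a Hamming sphere: group the
  \<open>m\<close>-subsets \<open>S\<close> by the size \<open>j\<close> of their intersection with \<open>W\<close>.\<close>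
lemma krawtchouk_character_sum:
  assumes "finite U" "card U = n" "W \<subseteq> U"
  shows "(\<Sum>S | S \<subseteq> U \<and> card S = m. (-1) ^ card (W \<inter> S)) = krawtchouk n m (real (card W))"
proof -
  let ?\<S> = "{S. S \<subseteq> U \<and> card S = m}"
  have finW: "finite W" and cW: "card W \<le> n"
    using finite_subset[OF assms(3,1)] card_mono[OF assms(1,3)] assms(2) by simp_all
  have fibre: "card {S \<in> ?\<S>. card (W \<inter> S) = j} = (card W choose j) * ((n - card W) choose (m - j))"
    if "j \<le> m" for j
  proof -
    have "bij_betw (\<lambda>(A, B). A \<union> B) ({A. A \<subseteq> W \<and> card A = j} \<times> {B. B \<subseteq> U - W \<and> card B = m - j})
            {S \<in> ?\<S>. card (W \<inter> S) = j}"
    proof (rule bij_betw_byWitness[where f' = "\<lambda>S. (W \<inter> S, S - W)"])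
      show "(\<lambda>(A, B). A \<union> B) ` ({A. A \<subseteq> W \<and> card A = j} \<times> {B. B \<subseteq> U - W \<and> card B = m - j})
          \<subseteq> {S \<in> ?\<S>. card (W \<inter> S) = j}"
      proof
        fix Z assume "Z \<in> (\<lambda>(A, B). A \<union> B) ` ({A. A \<subseteq> W \<and> card A = j} \<times> {B. B \<subseteq> U - W \<and> card B = m - j})"
        then obtain A B where A: "A \<subseteq> W" "card A = j" and B: "B \<subseteq> U - W" "card B = m - j"
          and Z: "Z = A \<union> B" by auto
        have fin: "finite A" "finite B"
          using finite_subset[OF A(1) finW] finite_subset[OF B(1)] assms(1) by simp_all
        have "card (A \<union> B) = card A + card B" using A B fin by (intro card_Un_disjoint) auto
        moreover have "W \<inter> (A \<union> B) = A" using A B by auto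
        ultimately show "Z \<in> {S \<in> ?\<S>. card (W \<inter> S) = j}"
          unfolding Z using A B that assms by auto
      qed
      show "(\<lambda>S. (W \<inter> S, S - W)) ` {S \<in> ?\<S>. card (W \<inter> S) = j}
          \<subseteq> {A. A \<subseteq> W \<and> card A = j} \<times> {B. B \<subseteq> U - W \<and> card B = m - j}"
      proof
        fix Z assume "Z \<in> (\<lambda>S. (W \<inter> S, S - W)) ` {S \<in> ?\<S>. card (W \<inter> S) = j}"
        then obtain S where S: "S \<subseteq> U" "card S = m" "card (W \<inter> S) = j"
          and Z: "Z = (W \<inter> S, S - W)" by auto
        have "card (S - W) = card S - card (S \<inter> W)"
          using finW by (simp add: card_Diff_subset_Int)
        then show "Z \<in> {A. A \<subseteq> W \<and> card A = j} \<times> {B. B \<subseteq> U - W \<and> card B = m - j}"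
          unfolding Z using S by (auto simp: Int_commute)
      qed
      show "\<forall>p\<in>{A. A \<subseteq> W \<and> card A = j} \<times> {B. B \<subseteq> U - W \<and> card B = m - j}.
              (W \<inter> (case p of (A, B) \<Rightarrow> A \<union> B), (case p of (A, B) \<Rightarrow> A \<union> B) - W) = p"
        by auto
      show "\<forall>S\<in>{S \<in> ?\<S>. card (W \<inter> S) = j}. (case (W \<inter> S, S - W) of (A, B) \<Rightarrow> A \<union> B) = S"
        by auto
    qed
    then have "card {S \<in> ?\<S>. card (W \<inter> S) = j}
        = card ({A. A \<subseteq> W \<and> card A = j} \<times> {B. B \<subseteq> U - W \<and> card B = m - j})"
      by (rule bij_betw_same_card[symmetric])
    then show ?thesis
      using finW assms n_subsets[of W j] n_subsets[of "U - W" "m - j"] card_Diff_subset[of W U]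
      by (simp add: card_cartesian_product)
  qed
  have diff: "real n - real (card W) = real (n - card W)"
    using cW by simp
  have "(\<Sum>S\<in>?\<S>. (-1 :: real) ^ card (W \<inter> S))
      = (\<Sum>j\<in>{0..m}. \<Sum>S\<in>{S \<in> ?\<S>. card (W \<inter> S) = j}. (-1) ^ card (W \<inter> S))"
  proof (rule sum.group[symmetric])
    show "(\<lambda>S. card (W \<inter> S)) ` ?\<S> \<subseteq> {0..m}"
    proof clarify
      fix S assume "S \<subseteq> U" "m = card S"
      then show "card (W \<inter> S) \<in> {0..card S}"
        using card_mono[OF finite_subset[OF _ assms(1)], of S "W \<inter> S"] by simp
    qed
  qed (use assms in auto)
  also have "\<dots> = (\<Sum>j=0..m. (-1) ^ j * real (card W choose j) * real ((n - card W) choose (m - j)))"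
  proof (rule sum.cong[OF refl])
    fix j assume "j \<in> {0..m}"
    then have c: "card {S \<in> ?\<S>. card (W \<inter> S) = j} = (card W choose j) * ((n - card W) choose (m - j))"
      by (intro fibre) simp
    have "(\<Sum>S\<in>{S \<in> ?\<S>. card (W \<inter> S) = j}. (-1 :: real) ^ card (W \<inter> S))
        = (\<Sum>S\<in>{S \<in> ?\<S>. card (W \<inter> S) = j}. (-1) ^ j)"
      by (rule sum.cong) auto
    then show "(\<Sum>S\<in>{S \<in> ?\<S>. card (W \<inter> S) = j}. (-1 :: real) ^ card (W \<inter> S))
        = (-1) ^ j * real (card W choose j) * real ((n - card W) choose (m - j))"
      by (simp only: sum_constant c of_nat_mult mult_ac)
  qed
  also have "\<dots> = krawtchouk n m (real (card W))"
    by (simp only: krawtchouk_def binomial_gbinomial diff)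
  finally show ?thesis .
qed

text \<open>Supports identify vectors over the two-element field with subsets, so that all Fourier
  analysis below takes place on a power set.\<close>
lemma supp_bij: "bij_betw (supp n) (GF2_vecs n) (Pow {1..n})"
proof (rule bij_betw_byWitness[where f' = "\<lambda>X. restrict (\<lambda>i. of_bool (i \<in> X)) {1..n}"])
  show "\<forall>x\<in>GF2_vecs n. restrict (\<lambda>i. of_bool (i \<in> supp n x)) {1..n} = x"
  proof
    fix x assume "x \<in> GF2_vecs n"
    then have "x \<in> extensional {1..n}" by (simp add: GF2_vecs_def PiE_def)
    moreover have "of_bool (x i = 1) = x i" for i by (cases "x i") auto
    ultimately show "restrict (\<lambda>i. of_bool (i \<in> supp n x)) {1..n} = x"
      by (intro extensionalityI[of _ "{1..n}"]) (auto simp: supp_def)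
  qed
  show "(\<lambda>X. restrict (\<lambda>i. of_bool (i \<in> X)) {1..n}) ` Pow {1..n} \<subseteq> GF2_vecs n"
    by (auto simp: GF2_vecs_def)
qed (auto simp: supp_def)

lemma dot_sign: "(-1 :: real) ^ of_bool (dot n w x = 1) = (-1) ^ card (supp n w \<inter> supp n x)"
proof -
  have one_iff_odd: "b = 1 \<longleftrightarrow> odd b" for b :: bit
    by (cases b) auto
  have "w i * x i = of_bool (w i = 1 \<and> x i = 1)" for i
    by (cases "w i"; cases "x i") auto
  then have "dot n w x = of_nat (card {i \<in> {1..n}. w i = 1 \<and> x i = 1})"
    unfolding dot_def by (simp add: Int_def)
  also have "{i \<in> {1..n}. w i = 1 \<and> x i = 1} = supp n w \<inter> supp n x"
    by (auto simp: supp_def)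
  finally have "dot n w x = 1 \<longleftrightarrow> odd (card (supp n w \<inter> supp n x))"
    by (simp only: one_iff_odd even_of_nat)
  then show ?thesis by (simp add: minus_one_power_iff)
qed

lemma walsh_char_fun:
  assumes "C \<subseteq> Pow {1..n}"
  shows "walsh n (char_fun n ({1..n}, C)) w = (\<Sum>x\<in>C. (-1) ^ card (supp n w \<inter> x))"
proof -
  have "walsh n (char_fun n ({1..n}, C)) w
      = (\<Sum>x\<in>GF2_vecs n. of_bool (supp n x \<in> C) * (-1) ^ card (supp n w \<inter> supp n x))"
    unfolding walsh_def char_fun_def snd_conv dot_sign by (simp only: of_bool_def)
  also have "\<dots> = (\<Sum>X\<in>Pow {1..n}. of_bool (X \<in> C) * (-1) ^ card (supp n w \<inter> X))"
    by (rule sum.reindex_bij_betw[OF supp_bij])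
  also have "\<dots> = (\<Sum>X\<in>C. of_bool (X \<in> C) * (-1) ^ card (supp n w \<inter> X))"
    using assms by (intro sum.mono_neutral_right) auto
  finally show ?thesis by simp
qed

text \<open>The Walsh transform turns the squared spectrum into the autocorrelation of \<open>C\<close>, and
  the Krawtchouk weight \<open>P\<^sub>m\<close> selects the pairs at Hamming distance \<open>m\<close>.\<close>
lemma walsh_krawtchouk_distance_count:
  assumes C: "C \<subseteq> Pow {1..n}"
  shows "(\<Sum>w\<in>GF2_vecs n. (walsh n (char_fun n ({1..n}, C)) w)\<^sup>2 * krawtchouk n m (real (wt n w)))
       = 2 ^ n * (\<Sum>x\<in>C. \<Sum>y\<in>C. of_bool (card (sym_diff x y) = m))"
proof -
  let ?\<chi> = "\<lambda>W x. (-1 :: real) ^ card (W \<inter> x)"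
  let ?\<S> = "{S. S \<subseteq> {1..n} \<and> card S = m}"
  have "(\<Sum>w\<in>GF2_vecs n. (walsh n (char_fun n ({1..n}, C)) w)\<^sup>2 * krawtchouk n m (real (wt n w)))
      = (\<Sum>w\<in>GF2_vecs n. (\<Sum>x\<in>C. ?\<chi> (supp n w) x)\<^sup>2 * krawtchouk n m (real (card (supp n w))))"
    by (simp only: walsh_char_fun[OF C] wt_def)
  also have "\<dots> = (\<Sum>W\<in>Pow {1..n}. (\<Sum>x\<in>C. ?\<chi> W x)\<^sup>2 * krawtchouk n m (real (card W)))"
    by (rule sum.reindex_bij_betw[OF supp_bij])
  also have "\<dots> = (\<Sum>W\<in>Pow {1..n}. \<Sum>(x, y)\<in>C \<times> C. \<Sum>S\<in>?\<S>. ?\<chi> W x * ?\<chi> W y * ?\<chi> W S)"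
  proof (rule sum.cong[OF refl])
    fix W :: "nat set" assume "W \<in> Pow {1..n}"
    then have K: "krawtchouk n m (real (card W)) = (\<Sum>S\<in>?\<S>. ?\<chi> W S)"
      using krawtchouk_character_sum[of "{1..n}" n W m] by simp
    have sq: "(\<Sum>x\<in>C. ?\<chi> W x)\<^sup>2 = (\<Sum>(x, y)\<in>C \<times> C. ?\<chi> W x * ?\<chi> W y)"
      by (simp only: power2_eq_square sum_product sum.cartesian_product)
    show "(\<Sum>x\<in>C. ?\<chi> W x)\<^sup>2 * krawtchouk n m (real (card W))
        = (\<Sum>(x, y)\<in>C \<times> C. \<Sum>S\<in>?\<S>. ?\<chi> W x * ?\<chi> W y * ?\<chi> W S)"
      unfolding K sq sum_product by (simp only: case_prod_unfold)
  qed
  also have "\<dots> = (\<Sum>(x, y)\<in>C \<times> C. \<Sum>S\<in>?\<S>. \<Sum>W\<in>Pow {1..n}. ?\<chi> W x * ?\<chi> W y * ?\<chi> W S)"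
    unfolding case_prod_beta by (subst sum.swap, rule sum.cong[OF refl], rule sum.swap)
  also have "\<dots> = (\<Sum>(x, y)\<in>C \<times> C. of_bool (card (sym_diff x y) = m) * 2 ^ n)"
  proof (rule sum.cong[OF refl], clarify)
    fix x y assume xy: "x \<in> C" "y \<in> C"
    have "(\<Sum>S\<in>?\<S>. \<Sum>W\<in>Pow {1..n}. ?\<chi> W x * ?\<chi> W y * ?\<chi> W S)
        = (\<Sum>S\<in>?\<S>. of_bool (S = sym_diff x y) * 2 ^ n)"
    proof (rule sum.cong[OF refl])
      fix S assume "S \<in> ?\<S>"
      then have "S \<subseteq> {1..n}" "x \<subseteq> {1..n}" "y \<subseteq> {1..n}" using xy C by auto
      from character_orthogonality[OF _ this(2,3,1)]
      show "(\<Sum>W\<in>Pow {1..n}. ?\<chi> W x * ?\<chi> W y * ?\<chi> W S) = of_bool (S = sym_diff x y) * 2 ^ n"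
        by simp
    qed
    also have "\<dots> = (\<Sum>S\<in>?\<S>. if S = sym_diff x y then 2 ^ n else 0)"
      by (intro sum.cong) auto
    also have "\<dots> = of_bool (sym_diff x y \<in> ?\<S>) * 2 ^ n"
      by (subst sum.delta) auto
    also have "sym_diff x y \<in> ?\<S> \<longleftrightarrow> card (sym_diff x y) = m"
      using xy C by auto
    finally show "(\<Sum>S\<in>?\<S>. \<Sum>W\<in>Pow {1..n}. ?\<chi> W x * ?\<chi> W y * ?\<chi> W S)
        = of_bool (card (sym_diff x y) = m) * 2 ^ n" .
  qed
  finally show ?thesis
    by (simp only: sum.cartesian_product sum_distrib_left case_prod_unfold mult.commute)
qed

section \<open>Comparison of the design and the spectral conditions\<close>

lemma card_sym_diff_uniform:
  assumes "finite x" "finite y" "card x = k" "card y = k"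
  shows "card (sym_diff x y) = 2 * (k - card (x \<inter> y))"
proof -
  have "card (sym_diff x y) = card (x - y) + card (y - x)"
    using assms by (intro card_Un_disjoint) auto
  then show ?thesis
    using assms by (simp add: card_Diff_subset_Int Int_commute)
qed

text \<open>The pairs of blocks at Hamming distance \<open>2 * j\<close> are those with \<open>card (x \<inter> y) = k - j\<close>, so
  summing the weights \<open>Q\<^sub>j(i) / v\<^sub>j\<close> over them produces the moments of the intersection sizes.\<close>
lemma spectral_sum_eq_moments:
  assumes C: "\<And>B. B \<in> C \<Longrightarrow> B \<subseteq> {1..n} \<and> card B = k" and "i \<le> k" "2 * k \<le> n"
  shows "(\<Sum>w\<in>GF2_vecs n. (walsh n (char_fun n ({1..n}, C)) w)\<^sup>2 *
           (\<Sum>j=0..k. mult n i / valency n k j * eberlein n k j (real i)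
                       * krawtchouk n (2 * j) (real (wt n w))))
       = 2 ^ n * mult n i * (\<Sum>s\<le>i. hahn_coeff n k i s * intersection_moment C s)"
proof -
  let ?p = "\<lambda>a. \<Sum>s\<le>i. hahn_coeff n k i s * real (a choose s)"
  let ?W = "\<lambda>w. (walsh n (char_fun n ({1..n}, C)) w)\<^sup>2"
  let ?P = "\<lambda>j w. krawtchouk n (2 * j) (real (wt n w))"
  have sub: "C \<subseteq> Pow {1..n}" using C by auto
  have weight: "mult n i / valency n k j * eberlein n k j (real i) = mult n i * ?p (k - j)"
    if "j \<in> {0..k}" for j
  proof -
    have "valency n k j \<noteq> 0" using that assms by (simp add: valency_def)
    then show ?thesis using eberlein_hahn_expansion[of i k j n] that assms by simp
  qed
  have "(\<Sum>w\<in>GF2_vecs n. ?W w * (\<Sum>j=0..k. mult n i / valency n k j * eberlein n k j (real i) * ?P j w))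
      = (\<Sum>w\<in>GF2_vecs n. ?W w * (\<Sum>j=0..k. mult n i * ?p (k - j) * ?P j w))"
    by (simp only: weight cong: sum.cong)
  also have "\<dots> = (\<Sum>w\<in>GF2_vecs n. \<Sum>j=0..k. mult n i * ?p (k - j) * (?W w * ?P j w))"
    unfolding sum_distrib_left[of "?W _"] by (simp only: mult_ac)
  also have "\<dots> = (\<Sum>j=0..k. mult n i * ?p (k - j) * (\<Sum>w\<in>GF2_vecs n. ?W w * ?P j w))"
    by (subst sum.swap) (simp only: sum_distrib_left[of "mult n i * _"])
  also have "\<dots> = (\<Sum>j=0..k. mult n i * ?p (k - j)
        * (2 ^ n * (\<Sum>(x, y)\<in>C \<times> C. of_bool (card (sym_diff x y) = 2 * j))))"
    by (simp only: walsh_krawtchouk_distance_count[OF sub] sum.cartesian_product)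
  also have "\<dots> = 2 ^ n * mult n i
        * (\<Sum>j=0..k. \<Sum>(x, y)\<in>C \<times> C. ?p (k - j) * of_bool (card (sym_diff x y) = 2 * j))"
  proof (subst sum_distrib_left, rule sum.cong[OF refl])
    fix j
    have "(\<Sum>(x, y)\<in>C \<times> C. ?p (k - j) * of_bool (card (sym_diff x y) = 2 * j))
        = ?p (k - j) * (\<Sum>(x, y)\<in>C \<times> C. of_bool (card (sym_diff x y) = 2 * j))"
      unfolding sum_distrib_left[of "?p (k - j)"] by (simp only: case_prod_unfold)
    from this[symmetric]
    show "mult n i * ?p (k - j) * (2 ^ n * (\<Sum>(x, y)\<in>C \<times> C. of_bool (card (sym_diff x y) = 2 * j)))
        = 2 ^ n * mult n i * (\<Sum>(x, y)\<in>C \<times> C. ?p (k - j) * of_bool (card (sym_diff x y) = 2 * j))"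
      by (simp only: mult_ac)
  qed
  also have "(\<Sum>j=0..k. \<Sum>(x, y)\<in>C \<times> C. ?p (k - j) * of_bool (card (sym_diff x y) = 2 * j))
      = (\<Sum>(x, y)\<in>C \<times> C. \<Sum>j=0..k. ?p (k - j) * of_bool (card (sym_diff x y) = 2 * j))"
    unfolding case_prod_unfold by (rule sum.swap)
  also have "\<dots> = (\<Sum>(x, y)\<in>C \<times> C. ?p (card (x \<inter> y)))"
  proof (rule sum.cong[OF refl], clarify)
    fix x y assume xy: "x \<in> C" "y \<in> C"
    have fin: "finite x" "finite y" using C xy by (meson finite_atLeastAtMost finite_subset)+
    have le: "card (x \<inter> y) \<le> k" using card_mono[OF fin(1), of "x \<inter> y"] C xy by simp
    have "(\<Sum>j=0..k. ?p (k - j) * of_bool (card (sym_diff x y) = 2 * j))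
        = (\<Sum>j=0..k. if j = k - card (x \<inter> y) then ?p (k - j) else 0)"
      using card_sym_diff_uniform[OF fin, of k] C xy by (intro sum.cong) auto
    also have "\<dots> = ?p (card (x \<inter> y))"
      using le by (subst sum.delta) auto
    finally show "(\<Sum>j=0..k. ?p (k - j) * of_bool (card (sym_diff x y) = 2 * j)) = ?p (card (x \<inter> y))" .
  qed
  also have "\<dots> = (\<Sum>s\<le>i. \<Sum>(x, y)\<in>C \<times> C. hahn_coeff n k i s * real (card (x \<inter> y) choose s))"
    unfolding case_prod_unfold by (rule sum.swap)
  also have "\<dots> = (\<Sum>s\<le>i. hahn_coeff n k i s * intersection_moment C s)"
    unfolding intersection_moment_def sum.cartesian_product sum_distrib_left[of "hahn_coeff _ _ _ _"]
    by (simp only: case_prod_unfold)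
  finally show ?thesis .
qed

lemma triangular_system_trivial_kernel:
  fixes a :: "nat \<Rightarrow> nat \<Rightarrow> 'a :: idom" and d :: "nat \<Rightarrow> 'a"
  assumes diag: "\<And>i. i \<in> {1..t} \<Longrightarrow> a i i \<noteq> 0" and "d 0 = 0"
  shows "(\<forall>i\<in>{1..t}. (\<Sum>s\<le>i. a i s * d s) = 0) \<longleftrightarrow> (\<forall>s\<le>t. d s = 0)"
proof
  assume eqs: "\<forall>i\<in>{1..t}. (\<Sum>s\<le>i. a i s * d s) = 0"
  have "s \<le> t \<longrightarrow> d s = 0" for s
  proof (induction s rule: less_induct)
    case (less s)
    show ?case
    proof (intro impI, cases "s = 0")
      case False
      assume "s \<le> t"
      with False have s: "s \<in> {1..t}" by simp
      have "(\<Sum>r\<le>s. a s r * d r) = (\<Sum>r\<in>{s}. a s r * d r)"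
        using less s by (intro sum.mono_neutral_right) auto
      then show "d s = 0" using eqs s diag[OF s] by simp
    qed (use assms in simp)
  qed
  then show "\<forall>s\<le>t. d s = 0" by simp
qed simp

theorem theorem43:
  fixes n k t :: nat and C :: "nat set set" and D :: "nat set \<times> nat set set"
  assumes "1 \<le> t" and "t \<le> k" and "real k \<le> real n / 2"
    and "C \<noteq> {}" and "\<And>B. B \<in> C \<Longrightarrow> B \<subseteq> {1..n} \<and> card B = k"
    and "D = ({1..n}, C)"
  shows "t_design t D \<longleftrightarrow>
    (\<forall>i\<in>{1..t}.
       (\<Sum>w\<in>GF2_vecs n. (walsh n (char_fun n D) w)\<^sup>2 *
          (\<Sum>j=0..k. mult n i / valency n k j * eberlein n k j (real i)
                      * krawtchouk n (2 * j) (real (wt n w)))) = 0)"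
proof -
  have kn: "2 * k \<le> n" using assms(3) by linarith
  let ?m = "\<lambda>s. (real (k choose s))\<^sup>2 / real (n choose s)"
  define d where "d s = intersection_moment C s - (real (card C))\<^sup>2 * ?m s" for s
  have design_iff: "t_design s D \<longleftrightarrow> d s = 0" if "s \<le> t" for s
    unfolding d_def assms(6)
    using t_design_iff_intersection_moment[of "{1..n}" n C k s] assms(2,5) that kn by simp
  have "t_design t D \<longleftrightarrow> (\<forall>s\<le>t. t_design s D)"
    unfolding assms(6)
    using t_design_mono[of "{1..n}" n C k _ t] assms(2,5) by auto
  also have "\<dots> \<longleftrightarrow> (\<forall>s\<le>t. d s = 0)"
    using design_iff by simp
  also have "\<dots> \<longleftrightarrow> (\<forall>i\<in>{1..t}. (\<Sum>s\<le>i. hahn_coeff n k i s * d s) = 0)"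
  proof (rule triangular_system_trivial_kernel[symmetric])
    show "hahn_coeff n k i i \<noteq> 0" if "i \<in> {1..t}" for i
      using hahn_coeff_leading_nonzero[of i k n] that assms(2) kn by simp
    show "d 0 = 0" by (simp add: d_def intersection_moment_def power2_eq_square)
  qed
  also have "\<dots> \<longleftrightarrow> (\<forall>i\<in>{1..t}.
       (\<Sum>w\<in>GF2_vecs n. (walsh n (char_fun n D) w)\<^sup>2 *
          (\<Sum>j=0..k. mult n i / valency n k j * eberlein n k j (real i)
                      * krawtchouk n (2 * j) (real (wt n w)))) = 0)"
  proof (rule ball_cong[OF refl])
    fix i assume i: "i \<in> {1..t}"
    then have ik: "i \<le> k" and i1: "1 \<le> i" using assms(2) by auto
    have "(\<Sum>s\<le>i. hahn_coeff n k i s * d s)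
        = (\<Sum>s\<le>i. hahn_coeff n k i s * intersection_moment C s)
          - (real (card C))\<^sup>2 * (\<Sum>s\<le>i. hahn_coeff n k i s * ?m s)"
      unfolding sum_distrib_left sum_subtractf[symmetric] d_def
      by (intro sum.cong refl) (simp add: algebra_simps)
    also have "\<dots> = (\<Sum>s\<le>i. hahn_coeff n k i s * intersection_moment C s)"
      by (simp only: hahn_coeff_annihilates_design_moments[OF i1 ik kn] mult_zero_right diff_zero)
    finally have moments: "(\<Sum>s\<le>i. hahn_coeff n k i s * d s)
        = (\<Sum>s\<le>i. hahn_coeff n k i s * intersection_moment C s)" .
    have "mult n i \<noteq> 0" using ik kn by (simp add: mult_def)
    then have nonzero: "2 ^ n * mult n i \<noteq> 0" by simp
    have D: "D = ({1..n}, C)" by (fact assms(6))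
    show "(\<Sum>s\<le>i. hahn_coeff n k i s * d s) = 0 \<longleftrightarrow>
       (\<Sum>w\<in>GF2_vecs n. (walsh n (char_fun n D) w)\<^sup>2 *
          (\<Sum>j=0..k. mult n i / valency n k j * eberlein n k j (real i)
                      * krawtchouk n (2 * j) (real (wt n w)))) = 0"
      unfolding D moments
      by (subst spectral_sum_eq_moments[OF assms(5) ik kn])
         (use nonzero in \<open>simp_all only: mult_eq_0_iff simp_thms\<close>)
  qed
  finally show ?thesis .
qed

end
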